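(* Let $C$ be a $(K,F,(1-\frac{M}{N}))$-caching matrix, with rows indexed by the set $\mathcal{U}$ of users and columns indexed by the set $\mathcal{F}$ of subfile indices, and let $\mathfrak{C}=\{C_1,\dots,C_S\}$ be an identity submatrix cover of $C$. For each $C_s\in\mathfrak{C}$ write its rows as $u_1,\dots,u_l$ and its columns as $f_1,\dots,f_l$, labelled so that $C(u_i,f_i)=1$ for all $i\in[l]$ and $C(u_i,f_j)=0$ for all $i\neq j$, and associate to $C_s$ the transmission $\sum_{i=1}^{l}W_{d_{u_i},f_i}$. Then, for all demands $(d_u)_{u\in\mathcal{U}}$, the collection of the $S$ transmissions associated to $C_1,\dots,C_S$ is a valid transmission scheme for the caching scheme defined by $C$ (i.e., it satisfies all the user demands), and the rate of this transmission scheme is $R=\frac{S}{F}$.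
   Context: Coded caching model: a server holds a library of $N$ files $W_1,\dots,W_N$ of equal size and is connected by an error-free broadcast link to $K$ users indexed by a set $\mathcal{U}$, $|\mathcal{U}|=K$. Each file $W_i$ is split into $F$ subfiles $W_{i,f}$, $f\in\mathcal{F}$, $|\mathcal{F}|=F$ ($F$ is the subpacketization level), all of the same size and taking values in an abelian group. Each user can cache a fraction $M/N$ of the library. After the caches are filled, each user $u$ demands a file $W_{d_u}$, $d_u\in[N]$. The server broadcasts transmissions, each a linear combination (sum) of subfiles of demanded files; a transmission scheme is valid if every user $u$ can recover all subfiles of $W_{d_u}$ from its cache and the transmissions. The rate is $R=\frac{\text{number of transmissions}}{F}$. Caching matrix: a binary ($0/1$) matrix $C$ with rows indexed by a $K$-set $\mathcal{U}$ and columns by an $F$-set $\mathcal{F}$, with the same number $Z$ of $1$'s in every row. It defines the caching scheme in which user $u$ caches $W_{i,f}$ for all $i\in[N]$ if $C(u,f)=0$, and does not cache it if $C(u,f)=1$; so the uncached fraction is $1-\frac{M}{N}=\frac{Z}{F}$. $C$ is then called a $(K,F,(1-\frac{M}{N}))$-caching matrix. Identity submatrix: an $l\times l$ submatrix $B$ of a binary matrix $A$ (given by a set of $l$ row indices and a set of $l$ column indices) is an identity submatrix of size $l$ if its columns are those of the $l\times l$ identity matrix in some order, i.e. $B$ is a permutation matrix. An entry $A(i,j)=1$ is covered by $B$ if $i$ is a row index and $j$ a column index of $B$. A set $\{C_1,\dots,C_S\}$ of identity submatrices of $A$ is an identity submatrix cover of $A$ if each non-zero entry of $A$ is covered by at least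 one $C_i$. *)

theory Defs
  imports Complex_Main "HOL-Library.FuncSet" "HOL-Library.Multiset"
begin

text \<open>
  Files are numbered by \<open>{1..N}\<close>; \<open>W i f\<close> is the subfile of the \<open>i\<close>-th file with
  subfile index \<open>f\<close>, a value in the abelian group \<open>'a\<close>.
\<close>

type_synonym ('f, 'a) library = "nat \<Rightarrow> 'f \<Rightarrow> 'a"

text \<open>A placement gives, for each user, the set of (file, subfile index) pairs it caches.\<close>

type_synonym ('u, 'f) placement = "'u \<Rightarrow> (nat \<times> 'f) set"

text \<open>The parameter \<open>q\<close> is the uncached fraction.\<close>

definition caching_matrix ::
  "'u set \<Rightarrow> 'f set \<Rightarrow> ('u \<Rightarrow> 'f \<Rightarrow> nat) \<Rightarrow> nat \<Rightarrow> nat \<Rightarrow> real \<Rightarrow> bool" where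
  "caching_matrix U Fs C K F q \<longleftrightarrow>
     finite U \<and> card U = K \<and> finite Fs \<and> card Fs = F \<and> 0 < F \<and>
     (\<forall>u\<in>U. \<forall>f\<in>Fs. C u f \<in> {0, 1}) \<and>
     (\<exists>Z. (\<forall>u\<in>U. card {f \<in> Fs. C u f = 1} = Z) \<and> q = real Z / real F)"

definition matrix_placement ::
  "nat \<Rightarrow> 'f set \<Rightarrow> ('u \<Rightarrow> 'f \<Rightarrow> nat) \<Rightarrow> ('u, 'f) placement" where
  "matrix_placement N Fs C u = {1..N} \<times> {f \<in> Fs. C u f = 0}"

text \<open>
  A submatrix is represented by the pair of its set of row indices and its set of column
  indices. The bijection \<open>\<pi>\<close> sends each row to the column in which that row has its \<open>1\<close>,
  which says that the submatrix is a permutation matrix.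
\<close>

definition identity_submatrix ::
  "'u set \<Rightarrow> 'f set \<Rightarrow> ('u \<Rightarrow> 'f \<Rightarrow> nat) \<Rightarrow> nat \<Rightarrow> 'u set \<times> 'f set \<Rightarrow> bool" where
  "identity_submatrix U Fs A l B \<longleftrightarrow>
     fst B \<subseteq> U \<and> snd B \<subseteq> Fs \<and> card (fst B) = l \<and> card (snd B) = l \<and>
     (\<exists>\<pi>. bij_betw \<pi> (fst B) (snd B) \<and>
        (\<forall>u\<in>fst B. \<forall>f\<in>snd B. A u f = (if f = \<pi> u then 1 else 0)))"

definition covered_by :: "'u \<Rightarrow> 'f \<Rightarrow> 'u set \<times> 'f set \<Rightarrow> bool" where
  "covered_by u f B \<longleftrightarrow> u \<in> fst B \<and> f \<in> snd B"

definition identity_submatrix_cover ::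
  "'u set \<Rightarrow> 'f set \<Rightarrow> ('u \<Rightarrow> 'f \<Rightarrow> nat) \<Rightarrow> ('u set \<times> 'f set) set \<Rightarrow> bool" where
  "identity_submatrix_cover U Fs A \<BB> \<longleftrightarrow>
     (\<forall>B\<in>\<BB>. \<exists>l. identity_submatrix U Fs A l B) \<and>
     (\<forall>u\<in>U. \<forall>f\<in>Fs. A u f \<noteq> 0 \<longrightarrow> (\<exists>B\<in>\<BB>. covered_by u f B))"

definition identity_labelling ::
  "('u \<Rightarrow> 'f \<Rightarrow> nat) \<Rightarrow> 'u set \<times> 'f set \<Rightarrow> nat \<Rightarrow> (nat \<Rightarrow> 'u) \<Rightarrow> (nat \<Rightarrow> 'f) \<Rightarrow> bool" where
  "identity_labelling A B l r c \<longleftrightarrow>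
     bij_betw r {1..l} (fst B) \<and> bij_betw c {1..l} (snd B) \<and>
     (\<forall>i\<in>{1..l}. A (r i) (c i) = 1) \<and>
     (\<forall>i\<in>{1..l}. \<forall>j\<in>{1..l}. i \<noteq> j \<longrightarrow> A (r i) (c j) = 0)"

lemma identity_labelling_exists:
  assumes "finite U" and "identity_submatrix U Fs A l B"
  shows "\<exists>r c. identity_labelling A B l r c"
proof -
  from assms(2) obtain \<pi> where sub: "fst B \<subseteq> U" and l: "card (fst B) = l"
    and \<pi>: "bij_betw \<pi> (fst B) (snd B)"
    and A: "\<forall>u\<in>fst B. \<forall>f\<in>snd B. A u f = (if f = \<pi> u then 1 else 0)"
    unfolding identity_submatrix_def by blast
  from sub assms(1) have "finite (fst B)" by (rule finite_subset)
  then obtain r where r: "bij_betw r {1..l} (fst B)"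
    using l ex_bij_betw_nat_finite_1 by blast
  have c: "bij_betw (\<pi> \<circ> r) {1..l} (snd B)"
    using r \<pi> by (rule bij_betw_trans)
  have in_r: "r i \<in> fst B" and in_c: "\<pi> (r i) \<in> snd B" if "i \<in> {1..l}" for i
    using bij_betw_apply[OF r that] bij_betw_apply[OF c that] by simp_all
  have neq: "\<pi> (r j) \<noteq> \<pi> (r i)" if "i \<in> {1..l}" "j \<in> {1..l}" "i \<noteq> j" for i j
    using inj_onD[OF bij_betw_imp_inj_on[OF c], of j i] that by auto
  have A_rc: "A (r i) ((\<pi> \<circ> r) j) = (if i = j then 1 else 0)"
    if "i \<in> {1..l}" "j \<in> {1..l}" for i j
    using bspec[OF bspec[OF A in_r[OF that(1)]] in_c[OF that(2)]] neq[OF that]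
    by (cases "i = j") simp_all
  have "identity_labelling A B l r (\<pi> \<circ> r)"
    unfolding identity_labelling_def
    by (intro conjI ballI impI r c) (simp_all add: A_rc del: o_apply)
  then show ?thesis by blast
qed

text \<open>
  A transmission is the map from library contents to the transmitted symbol. A multiset
  lists the summands, so that a subfile may occur repeatedly.
\<close>

definition sum_of_demanded_subfiles ::
  "'u set \<Rightarrow> 'f set \<Rightarrow> ('u \<Rightarrow> nat) \<Rightarrow> (('f, 'a::ab_group_add) library \<Rightarrow> 'a) \<Rightarrow> bool" where
  "sum_of_demanded_subfiles U Fs d x \<longleftrightarrow>
     (\<exists>T. set_mset T \<subseteq> d ` U \<times> Fs \<and> (\<forall>W. x W = (\<Sum>(i, f)\<in>#T. W i f)))"

text \<open>
  User \<open>u\<close> decodes by a function \<open>D\<close> of the content of its cache and of the transmitted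
  symbols only: \<open>D\<close> may depend on the demands and the scheme, but not on the library \<open>W\<close>.
\<close>

definition can_recover_demand ::
  "'f set \<Rightarrow> ('u, 'f) placement \<Rightarrow> ('u \<Rightarrow> nat) \<Rightarrow>
   't set \<Rightarrow> ('t \<Rightarrow> ('f, 'a::ab_group_add) library \<Rightarrow> 'a) \<Rightarrow> 'u \<Rightarrow> bool" where
  "can_recover_demand Fs P d T X u \<longleftrightarrow>
     (\<exists>D :: (nat \<times> 'f \<Rightarrow> 'a) \<Rightarrow> ('t \<Rightarrow> 'a) \<Rightarrow> 'f \<Rightarrow> 'a. \<forall>W. \<forall>f\<in>Fs.
        D (\<lambda>(i, g)\<in>P u. W i g) (\<lambda>t\<in>T. X t W) f = W (d u) f)"

text \<open>
  The transmissions form a family \<open>X\<close> over the index set \<open>T\<close>, so that two transmissions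
  which happen to be the same sum are still counted separately.
\<close>

definition valid_transmission_scheme ::
  "'u set \<Rightarrow> 'f set \<Rightarrow> ('u, 'f) placement \<Rightarrow> ('u \<Rightarrow> nat) \<Rightarrow>
   't set \<Rightarrow> ('t \<Rightarrow> ('f, 'a::ab_group_add) library \<Rightarrow> 'a) \<Rightarrow> bool" where
  "valid_transmission_scheme U Fs P d T X \<longleftrightarrow>
     finite T \<and>
     (\<forall>t\<in>T. sum_of_demanded_subfiles U Fs d (X t)) \<and>
     (\<forall>u\<in>U. can_recover_demand Fs P d T X u)"

definition rate ::
  "'f set \<Rightarrow> 't set \<Rightarrow> ('t \<Rightarrow> ('f, 'a::ab_group_add) library \<Rightarrow> 'a) \<Rightarrow> real" where
  "rate Fs T X = real (card T) / real (card Fs)"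

definition labelled_transmission ::
  "('u \<Rightarrow> nat) \<Rightarrow> nat \<Rightarrow> (nat \<Rightarrow> 'u) \<Rightarrow> (nat \<Rightarrow> 'f) \<Rightarrow>
   ('f, 'a::ab_group_add) library \<Rightarrow> 'a" where
  "labelled_transmission d l r c W = (\<Sum>i=1..l. W (d (r i)) (c i))"

end

theory Submission
  imports Defs
begin

text \<open>
  A decoder exists as soon as the cached and transmitted symbols determine the demanded file.
  For user \<open>u = r i\<close> and a missing subfile \<open>f = c i\<close>, every other summand
  \<open>W (d (r j)) (c j)\<close> of a transmission covering \<open>(u, f)\<close> has \<open>C u (c j) = 0\<close>, so \<open>u\<close> has
  cached it and can subtract it.
\<close>

lemma can_recover_demandI:
  fixes X :: "'t \<Rightarrow> ('f, 'a::ab_group_add) library \<Rightarrow> 'a"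
  assumes "\<And>W W' f. \<lbrakk>f \<in> Fs; \<And>i g. (i, g) \<in> P u \<Longrightarrow> W i g = W' i g;
      \<And>t. t \<in> T \<Longrightarrow> X t W = X t W'\<rbrakk> \<Longrightarrow> W (d u) f = W' (d u) f"
  shows "can_recover_demand Fs P d T X u"
proof -
  \<comment> \<open>Restricted functions are \<open>undefined\<close> off their domain, so two
    libraries have equal views exactly when they agree on the cached pairs and on the transmitted
    symbols.\<close>
  define view where "view W = (\<lambda>(i, g)\<in>P u. W i g, \<lambda>t\<in>T. X t W)" for W
  \<comment> \<open>The decoder sees only \<open>(k, x)\<close>: it picks any library consistent
    with that view and reads the demanded file from it. On unrealizable views its value is
    arbitrary.\<close>
  define D where "D k x = (SOME W. view W = (k, x)) (d u)" for k x
  have "D (\<lambda>(i, g)\<in>P u. W i g) (\<lambda>t\<in>T. X t W) f = W (d u) f" if f: "f \<in> Fs" for W f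
  proof -
    \<comment> \<open>The library picked may differ from \<open>W\<close>, but it has the same view,
      so the assumption makes the two agree on the demanded file.\<close>
    define W' where "W' = (SOME W'. view W' = view W)"
    have "view W' = view W"
      unfolding W'_def by (rule someI[of "\<lambda>W'. view W' = view W" W]) (rule refl)
    then have k: "(\<lambda>(i, g)\<in>P u. W' i g) = (\<lambda>(i, g)\<in>P u. W i g)"
      and x: "(\<lambda>t\<in>T. X t W') = (\<lambda>t\<in>T. X t W)"
      by (simp_all add: view_def)
    have cache: "W' i g = W i g" if "(i, g) \<in> P u" for i g
      using fun_cong[OF k, of "(i, g)"] that by simp
    have trans: "X t W' = X t W" if "t \<in> T" for t
      using fun_cong[OF x, of t] that by simp
    have "W' (d u) f = W (d u) f"
      by (rule assms[of f W' W]) (fact f cache trans)+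
    then show ?thesis
      by (simp add: D_def W'_def view_def)
  qed
  then show ?thesis
    unfolding can_recover_demand_def by blast
qed

text \<open>Each member is a pair of subsets of two finite sets. This supplies the finiteness that
  validity demands, which \<open>card \<CC> = S\<close> alone does not give when
  \<open>S = 0\<close>.\<close>

lemma identity_submatrix_cover_finite:
  assumes "finite U" "finite Fs" "identity_submatrix_cover U Fs A \<BB>"
  shows "finite \<BB>"
proof (rule finite_subset)
  show "\<BB> \<subseteq> Pow U \<times> Pow Fs"
    using assms(3) by (force simp: identity_submatrix_cover_def identity_submatrix_def)
  show "finite (Pow U \<times> Pow Fs)"
    using assms by simp
qed

lemma sum_of_demanded_subfiles_labelled_transmission:
  assumes "r ` {1..l} \<subseteq> U" "c ` {1..l} \<subseteq> Fs"
  shows "sum_of_demanded_subfiles U Fs d (labelled_transmission d l r c)"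
  unfolding sum_of_demanded_subfiles_def
proof (intro exI conjI allI)
  \<comment> \<open>One summand per index \<open>i\<close>; the multiset image keeps multiplicities,
    so its sum is the sum over \<open>{1..l}\<close>.\<close>
  let ?T = "image_mset (\<lambda>i. (d (r i), c i)) (mset_set {1..l})"
  show "set_mset ?T \<subseteq> d ` U \<times> Fs"
    using assms by auto
  show "labelled_transmission d l r c W = (\<Sum>(i, f)\<in>#?T. W i f)" for W
    by (simp add: labelled_transmission_def sum_unfold_sum_mset image_mset.compositionality comp_def)
qed

theorem theorem1:
  fixes U :: "'u set" and Fs :: "'f set" and C :: "'u \<Rightarrow> 'f \<Rightarrow> nat"
    and K F N S :: nat and M :: real
    and \<CC> :: "('u set \<times> 'f set) set"
    and l :: "'u set \<times> 'f set \<Rightarrow> nat"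
    and r :: "'u set \<times> 'f set \<Rightarrow> nat \<Rightarrow> 'u"
    and c :: "'u set \<times> 'f set \<Rightarrow> nat \<Rightarrow> 'f"
    and X :: "('u \<Rightarrow> nat) \<Rightarrow> 'u set \<times> 'f set \<Rightarrow> ('f, 'a::ab_group_add) library \<Rightarrow> 'a"
  assumes "0 < N"
    and "caching_matrix U Fs C K F (1 - M / real N)"
    and "identity_submatrix_cover U Fs C \<CC>"
    and "card \<CC> = S"
    and "\<And>B. B \<in> \<CC> \<Longrightarrow> identity_labelling C B (l B) (r B) (c B)"
    and X: "\<And>d B. X d B = labelled_transmission d (l B) (r B) (c B)"
  shows "\<forall>d. (\<forall>u\<in>U. d u \<in> {1..N}) \<longrightarrow>
           valid_transmission_scheme U Fs (matrix_placement N Fs C) d \<CC> (X d) \<and>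
           rate Fs \<CC> (X d) = real S / real F"
proof (intro allI impI)
  fix d
  assume d: "\<forall>u\<in>U. d u \<in> {1..N}"
  have fin: "finite U" "finite Fs" and F: "card Fs = F"
    using assms(2) by (auto simp: caching_matrix_def)
  have sub: "fst B \<subseteq> U" "snd B \<subseteq> Fs" if "B \<in> \<CC>" for B
    using assms(3) that by (auto simp: identity_submatrix_cover_def identity_submatrix_def)
  have r: "r B ` {1..l B} = fst B" and c: "c B ` {1..l B} = snd B"
    and zero: "\<And>i j. \<lbrakk>i \<in> {1..l B}; j \<in> {1..l B}; i \<noteq> j\<rbrakk> \<Longrightarrow> C (r B i) (c B j) = 0"
    if "B \<in> \<CC>" for B
    using assms(5)[OF that] by (auto simp: identity_labelling_def bij_betw_def)
  have rU: "r B i \<in> U" and cFs: "c B i \<in> Fs" if "B \<in> \<CC>" "i \<in> {1..l B}" for B i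
    using imageI[OF that(2), of "r B"] imageI[OF that(2), of "c B"]
      r[OF that(1)] c[OF that(1)] sub[OF that(1)] by auto
  have "can_recover_demand Fs (matrix_placement N Fs C) d \<CC> (X d) u" if u: "u \<in> U" for u
  proof (rule can_recover_demandI)
    fix W W' :: "('f, 'a) library" and f
    assume f: "f \<in> Fs"
      and cache: "\<And>i g. (i, g) \<in> matrix_placement N Fs C u \<Longrightarrow> W i g = W' i g"
      and trans: "\<And>B. B \<in> \<CC> \<Longrightarrow> X d B W = X d B W'"
    \<comment> \<open>A zero at \<open>(u, g)\<close> caches subfile \<open>g\<close> of every file,
      hence also of the file demanded by another user \<open>v\<close>; all demands lie in
      \<open>{1..N}\<close>.\<close>
    have cached: "W (d v) g = W' (d v) g" if "v \<in> U" "g \<in> Fs" "C u g = 0" for v g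
      using cache d that by (simp add: matrix_placement_def)
    show "W (d u) f = W' (d u) f"
    proof (cases "C u f = 0")
      case True
      with u f show ?thesis by (rule cached)
    next
      case False
      with assms(3) u f have "\<exists>B\<in>\<CC>. covered_by u f B"
        by (simp add: identity_submatrix_cover_def)
      then obtain B where B: "B \<in> \<CC>" "u \<in> fst B" "f \<in> snd B"
        unfolding covered_by_def by blast
      obtain i where i: "i \<in> {1..l B}" "r B i = u"
        using B(2) unfolding r[OF B(1), symmetric] by blast
      \<comment> \<open>Covering yields the row label \<open>i\<close> and the column label
        \<open>j\<close> separately. Off-diagonal entries vanish and \<open>C u f\<close> does not,
        which forces \<open>i = j\<close>.\<close>
      obtain j where "j \<in> {1..l B}" "c B j = f"
        using B(3) unfolding c[OF B(1), symmetric] by blast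
      with i False zero[OF B(1), of i j] have ci: "c B i = f"
        by auto
      let ?J = "{1..l B} - {i}"
      have split: "X d B V = V (d u) f + (\<Sum>j\<in>?J. V (d (r B j)) (c B j))" for V
        using i ci by (simp add: X labelled_transmission_def sum.remove[of _ i])
      \<comment> \<open>In row \<open>u\<close> of the submatrix all columns but \<open>f\<close>
        carry zeros, so the interfering summands agree for both libraries and cancel in the equal
        transmissions.\<close>
      have "(\<Sum>j\<in>?J. W (d (r B j)) (c B j)) = (\<Sum>j\<in>?J. W' (d (r B j)) (c B j))"
        using zero[OF B(1) i(1)] i(2) B(1) by (intro sum.cong refl cached rU cFs) auto
      with trans[OF B(1)] show ?thesis
        by (simp add: split)
    qed
  qed
  moreover have "sum_of_demanded_subfiles U Fs d (X d B)" if "B \<in> \<CC>" for B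
    unfolding X using rU[OF that] cFs[OF that]
    by (intro sum_of_demanded_subfiles_labelled_transmission image_subsetI)
  ultimately show "valid_transmission_scheme U Fs (matrix_placement N Fs C) d \<CC> (X d) \<and>
           rate Fs \<CC> (X d) = real S / real F"
    \<comment> \<open>The transmissions are indexed by \<CC> itself, so the rate counts
      \<open>card \<CC> = S\<close> of them.\<close>
    using identity_submatrix_cover_finite[OF fin assms(3)] assms(4) F
    by (simp add: valid_transmission_scheme_def rate_def)
qed

end
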